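(* Let $\Gamma$ be a simple digraph and let $t$ be a positive integer. Then $\operatorname{th}(\Gamma)\le t$ if and only if there exist integers $a\ge 1$ and $b\ge 0$ with $a+b=t$ such that $\Gamma$ can be obtained (up to isomorphism) from the digraph $H_{a,b+1}$ by contracting path arcs and deleting non-path arcs.
   Context: A simple digraph $\Gamma$ has a finite vertex set $V(\Gamma)$ and arc set $E(\Gamma)$ with no loops and no parallel arcs (a pair of opposite arcs $(u,v),(v,u)$, called double arcs, is allowed). If $(u,v)\in E(\Gamma)$, then $v$ is an out-neighbor of $u$. Zero forcing: every vertex is blue or white; the color change rule says that a blue vertex $u$ with exactly one white out-neighbor $w$ may force $w$ (written $u\to w$), turning $w$ blue. A set $\mathcal F$ of forces is a set of forces of $B\subseteq V(\Gamma)$ if, starting with exactly $B$ blue, the forces of $\mathcal F$ can be validly performed in some order after which no further valid force is possible. For such $\mathcal F$ put $\mathcal F^{[0]}=B$ and $\mathcal F^{[t+1]}=\mathcal F^{[t]}\cup\{w\notin\mathcal F^{[t]}: (u\to w)\in\mathcal F$ for some $u\in \mathcal F^{[t]}$ such that $w$ is the only out-neighbor of $u$ outside $\mathcal F^{[t]}\}$. The propagation time $\operatorname{pt}(\Gamma;\mathcal F)$ is the least $t$ with $\mathcal F^{[t]}=V(\Gamma)$ ($\infty$ if none). $B$ is a zero forcing set if starting from $B$ all vertices can be forced blue. $\operatorname{pt}(\Gamma;B)$ is the minimum of $\operatorname{pt}(\Gamma;\mathcal F)$ over all sets of forces $\mathcal F$ of $B$; $\operatorname{th}(\Gamma;B)=|B|+\operatorname{pt}(\Gamma;B)$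 and the throttling number is $\operatorname{th}(\Gamma)=\min\{\operatorname{th}(\Gamma;B): B\subseteq V(\Gamma)\}$. For integers $a\ge1$, $b\ge0$, the digraph $H_{a,b+1}$ has vertices $v_{i,j}$, $0\le i\le a-1$, $0\le j\le b$ (row $i$, column $j$). Start with all arcs between distinct vertices in both directions, then delete every arc $(v_{h,k},v_{l,m})$ with $h\ne l$ and $m>k$, and every arc $(v_{h,k},v_{h,m})$ with $m>k+1$. Thus $(v_{h,k},v_{l,m})$ is an arc iff the vertices are distinct and either $m\le k$, or $h=l$ and $m=k+1$. The path arcs are the arcs $(v_{i,j},v_{i,j+1})$ for $0\le i\le a-1$, $0\le j\le b-1$; all other arcs are non-path arcs. Contracting an arc identifies its two endpoints into one vertex (keeping a simple digraph, i.e. discarding loops and duplicate arcs).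
   Formalization: The digraph is assumed to have at least one vertex; for the empty digraph the throttling number is 0, but no empty digraph can be obtained from H_{a,b+1} with a ≥ 1, so the equivalence fails there. *)

theory Defs
  imports
    "Graph_Theory.Pair_Digraph"
    "Graph_Theory.Digraph_Isomorphism"
    "HOL-Library.Extended_Nat"
begin

text \<open>Simple digraphs are the \<^locale>\<open>pair_digraph\<close>s of the library: arcs are ordered
  pairs of vertices, so there are no parallel arcs, while opposite arcs are allowed.\<close>

subsection \<open>Zero forcing and throttling\<close>

definition out_nbrs :: "'a pair_pre_digraph \<Rightarrow> 'a \<Rightarrow> 'a set" where
  "out_nbrs G u = {v. (u, v) \<in> parcs G}"

definition can_force :: "'a pair_pre_digraph \<Rightarrow> 'a set \<Rightarrow> 'a \<Rightarrow> 'a \<Rightarrow> bool" where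
  "can_force G S u w \<longleftrightarrow> u \<in> S \<and> out_nbrs G u - S = {w}"

fun valid_forces :: "'a pair_pre_digraph \<Rightarrow> 'a set \<Rightarrow> ('a \<times> 'a) list \<Rightarrow> bool" where
  "valid_forces G S [] \<longleftrightarrow> True"
| "valid_forces G S ((u, w) # fs) \<longleftrightarrow> can_force G S u w \<and> valid_forces G (insert w S) fs"

text \<open>After performing the forces \<open>fs\<close>, the blue set is \<open>B \<union> snd ` set fs\<close>.\<close>

definition set_of_forces :: "'a pair_pre_digraph \<Rightarrow> 'a set \<Rightarrow> ('a \<times> 'a) set \<Rightarrow> bool" where
  "set_of_forces G B F \<longleftrightarrow>
     (\<exists>fs. set fs = F \<and> valid_forces G B fs \<and> (\<nexists>u w. can_force G (B \<union> snd ` set fs) u w))"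

primrec forced_upto :: "'a pair_pre_digraph \<Rightarrow> 'a set \<Rightarrow> ('a \<times> 'a) set \<Rightarrow> nat \<Rightarrow> 'a set" where
  "forced_upto G B F 0 = B"
| "forced_upto G B F (Suc t) = forced_upto G B F t \<union>
     {w. w \<notin> forced_upto G B F t \<and> (\<exists>u. (u, w) \<in> F \<and> can_force G (forced_upto G B F t) u w)}"

text \<open>In \<^typ>\<open>enat\<close>, the infimum of a nonempty set is its minimum and the infimum of the
  empty set is \<open>\<infinity>\<close>.\<close>

definition pt_forces :: "'a pair_pre_digraph \<Rightarrow> 'a set \<Rightarrow> ('a \<times> 'a) set \<Rightarrow> enat" where
  "pt_forces G B F = Inf {enat t |t. forced_upto G B F t = pverts G}"

definition pt_set :: "'a pair_pre_digraph \<Rightarrow> 'a set \<Rightarrow> enat" where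
  "pt_set G B = Inf {pt_forces G B F |F. set_of_forces G B F}"

definition th_set :: "'a pair_pre_digraph \<Rightarrow> 'a set \<Rightarrow> enat" where
  "th_set G B = enat (card B) + pt_set G B"

definition throttling_number :: "'a pair_pre_digraph \<Rightarrow> enat" where
  "throttling_number G = Inf {th_set G B |B. B \<subseteq> pverts G}"

subsection \<open>The digraph $H_{a,n}$ with $a$ rows and $n$ columns\<close>

text \<open>The vertex $v_{i,j}$ in row $i$ and column $j$ is the pair \<open>(i, j)\<close>.\<close>

definition H_verts :: "nat \<Rightarrow> nat \<Rightarrow> (nat \<times> nat) set" where
  "H_verts a n = {0..<a} \<times> {0..<n}"

definition H_digraph :: "nat \<Rightarrow> nat \<Rightarrow> (nat \<times> nat) pair_pre_digraph" where
  "H_digraph a n = \<lparr> pverts = H_verts a n,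
     parcs = {(x, y). x \<in> H_verts a n \<and> y \<in> H_verts a n \<and> x \<noteq> y}
       - {((h, k), (l, m)) |h k l m. h \<noteq> l \<and> m > k}
       - {((h, k), (h, m)) |h k m. m > k + 1} \<rparr>"

lemma H_digraph_arc_iff:
  "((h, k), (l, m)) \<in> parcs (H_digraph a n) \<longleftrightarrow>
     (h, k) \<in> H_verts a n \<and> (l, m) \<in> H_verts a n \<and> (h, k) \<noteq> (l, m) \<and>
     (m \<le> k \<or> h = l \<and> m = k + 1)"
  by (auto simp: H_digraph_def)

lemma pair_digraph_H: "pair_digraph (H_digraph a n)"
proof -
  have "finite (parcs (H_digraph a n))"
    by (rule finite_subset[of _ "H_verts a n \<times> H_verts a n"])
       (auto simp: H_digraph_def H_verts_def)
  then show ?thesis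
    by unfold_locales (auto simp: H_digraph_def H_verts_def)
qed

definition H_path_arcs :: "nat \<Rightarrow> nat \<Rightarrow> ((nat \<times> nat) \<times> (nat \<times> nat)) set" where
  "H_path_arcs a n = {((i, j), (i, j + 1)) |i j. i < a \<and> j + 1 < n}"

subsection \<open>Contracting path arcs and deleting non-path arcs\<close>

text \<open>Contracting \<open>(u, v)\<close> identifies \<open>v\<close> with \<open>u\<close>; the merged vertex keeps the name \<open>u\<close>.\<close>

definition merge_into :: "'a \<Rightarrow> 'a \<Rightarrow> 'a \<Rightarrow> 'a" where
  "merge_into u v x = (if x = v then u else x)"

definition contract_arcs :: "'a \<Rightarrow> 'a \<Rightarrow> ('a \<times> 'a) set \<Rightarrow> ('a \<times> 'a) set" where
  "contract_arcs u v A =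
     {(merge_into u v x, merge_into u v y) |x y. (x, y) \<in> A \<and> merge_into u v x \<noteq> merge_into u v y}"

definition contract :: "'a pair_pre_digraph \<Rightarrow> 'a \<Rightarrow> 'a \<Rightarrow> 'a pair_pre_digraph" where
  "contract G u v =
     \<lparr> pverts = merge_into u v ` pverts G, parcs = contract_arcs u v (parcs G) \<rparr>"

definition delete_arc :: "'a pair_pre_digraph \<Rightarrow> 'a \<times> 'a \<Rightarrow> 'a pair_pre_digraph" where
  "delete_arc G e = \<lparr> pverts = pverts G, parcs = parcs G - {e} \<rparr>"

text \<open>\<open>reduces_to G P G' P'\<close>: starting from \<open>G\<close> with set of path arcs \<open>P\<close>, finitely many
  contractions of path arcs and deletions of non-path arcs, in any order, lead to \<open>G'\<close>, where
  the path arcs \<open>P'\<close> of \<open>G'\<close> are those stemming from the arcs in \<open>P\<close>.\<close>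

inductive reduces_to ::
  "'a pair_pre_digraph \<Rightarrow> ('a \<times> 'a) set \<Rightarrow> 'a pair_pre_digraph \<Rightarrow> ('a \<times> 'a) set \<Rightarrow> bool"
  for G P where
  refl: "reduces_to G P G P"
| contract_path_arc: "reduces_to G P G' P' \<Longrightarrow> (u, v) \<in> P' \<Longrightarrow>
    reduces_to G P (contract G' u v) (contract_arcs u v P')"
| delete_non_path_arc: "reduces_to G P G' P' \<Longrightarrow> e \<in> parcs G' - P' \<Longrightarrow>
    reduces_to G P (delete_arc G' e) P'"

definition obtainable_from_H :: "'a pair_pre_digraph \<Rightarrow> nat \<Rightarrow> nat \<Rightarrow> bool" where
  "obtainable_from_H \<Gamma> a n \<longleftrightarrow>
     (\<exists>G' P'. reduces_to (H_digraph a n) (H_path_arcs a n) G' P' \<and>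
              digraph_iso (with_proj G') (with_proj \<Gamma>))"

end

theory Submission
  imports Defs
begin

text \<open>
  Both sides of the equivalence say that \<open>\<Gamma>\<close> carries a surjection \<open>f\<close> from the vertices of
  $H_{a,b+1}$ whose fibres are intervals inside rows, such that every arc of \<open>\<Gamma>\<close> is the image of
  an arc and the image of every path arc is a vertex or an arc of \<open>\<Gamma>\<close>.

  Such a surjection turns the columns into time steps: \<open>f\<close> of column \<open>0\<close> is a set of \<open>a\<close> blue
  vertices, and by time \<open>k\<close> the forces along path arcs have coloured the images of all columns up
  to \<open>k\<close>. Conversely, the forces of a set \<open>B\<close> split the vertices into \<open>card B\<close> forcing chains, and
  \<open>f (i, j)\<close> is the last vertex of chain \<open>i\<close> that is blue at time \<open>j\<close>. A vertex forces only
  when all its other out-neighbours are blue, so these appear no later than the last column of its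
  fibre, which makes every arc the image of an arc of $H_{a,b+1}$.
\<close>

subsection \<open>Quotients of $H_{a,n}$\<close>

text \<open>This extends \<open>contract_arcs\<close> from \<open>merge_into u v\<close> to an
  arbitrary vertex map, so that a whole sequence of contractions is described by one composed
  map.\<close>

definition quotient_arcs :: "('a \<Rightarrow> 'b) \<Rightarrow> ('a \<times> 'a) set \<Rightarrow> ('b \<times> 'b) set" where
  "quotient_arcs f A = {(f x, f y) |x y. (x, y) \<in> A \<and> f x \<noteq> f y}"

lemma contract_arcs_eq_quotient_arcs: "contract_arcs u v = quotient_arcs (merge_into u v)"
  by (auto simp: fun_eq_iff contract_arcs_def quotient_arcs_def)

text \<open>An arc that \<open>f\<close> turns into a loop is still a loop after \<open>g\<close>,
  so discarding loops early loses nothing.\<close>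

lemma quotient_arcs_comp: "quotient_arcs g (quotient_arcs f A) = quotient_arcs (g \<circ> f) A"
  unfolding quotient_arcs_def by auto metis

lemma quotient_arcs_mono: "A \<subseteq> A' \<Longrightarrow> quotient_arcs f A \<subseteq> quotient_arcs f A'"
  unfolding quotient_arcs_def by blast

lemma quotient_arcs_inj_comp:
  assumes "inj_on h (f ` S)" "A \<subseteq> S \<times> S"
  shows "quotient_arcs (h \<circ> f) A = map_prod h h ` quotient_arcs f A"
proof -
  have "h (f x) \<noteq> h (f y) \<longleftrightarrow> f x \<noteq> f y" if "(x, y) \<in> A" for x y
    using inj_on_eq_iff[OF assms(1)] assms(2) that by blast
  then show ?thesis unfolding quotient_arcs_def by force
qed

lemma quotient_arcs_cong:
  assumes "A \<subseteq> S \<times> S" "\<And>x. x \<in> S \<Longrightarrow> f x = g x"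
  shows "quotient_arcs f A = quotient_arcs g A"
proof -
  have "f x = g x \<and> f y = g y" if "(x, y) \<in> A" for x y using assms that by blast
  then show ?thesis unfolding quotient_arcs_def by (auto; metis)
qed

lemma quotient_arcs_id: "(\<And>x. (x, x) \<notin> A) \<Longrightarrow> quotient_arcs id A = A"
  unfolding quotient_arcs_def by auto

lemma quotient_arcs_id_H_path_arcs [simp]: "quotient_arcs id (H_path_arcs a n) = H_path_arcs a n"
  by (rule quotient_arcs_id) (auto simp: H_path_arcs_def)

lemma quotient_arcs_id_H_digraph [simp]:
  "quotient_arcs id (parcs (H_digraph a n)) = parcs (H_digraph a n)"
  by (rule quotient_arcs_id) (auto simp: H_digraph_arc_iff)

lemma quotient_arcs_H_path_arcs:
  "quotient_arcs f (H_path_arcs a n) =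
     {(f (i, j), f (i, Suc j)) |i j. i < a \<and> Suc j < n \<and> f (i, j) \<noteq> f (i, Suc j)}"
  by (fastforce simp: quotient_arcs_def H_path_arcs_def)

lemma parcs_H_digraph_subset: "parcs (H_digraph a n) \<subseteq> H_verts a n \<times> H_verts a n"
  by (auto simp: H_digraph_def)

lemma H_path_arcs_subset: "H_path_arcs a n \<subseteq> parcs (H_digraph a n)"
  by (auto simp: H_digraph_arc_iff H_path_arcs_def H_verts_def)

text \<open>The arc set is only bounded from both sides: images of path arcs must survive because
  path arcs are never deleted, while any other arc may be missing. The row and interval conditions
  record that only neighbours within one row are ever merged.\<close>

definition H_quotient :: "(nat \<times> nat \<Rightarrow> 'a) \<Rightarrow> nat \<Rightarrow> nat \<Rightarrow> 'a pair_pre_digraph \<Rightarrow> bool" where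
  "H_quotient f a n G \<longleftrightarrow>
     pverts G = f ` H_verts a n \<and>
     (\<forall>i j i' j'. (i, j) \<in> H_verts a n \<longrightarrow> (i', j') \<in> H_verts a n \<longrightarrow> f (i, j) = f (i', j') \<longrightarrow> i = i') \<and>
     (\<forall>i j k l. (i, l) \<in> H_verts a n \<longrightarrow> j \<le> k \<longrightarrow> k \<le> l \<longrightarrow> f (i, j) = f (i, l) \<longrightarrow> f (i, k) = f (i, j)) \<and>
     quotient_arcs f (H_path_arcs a n) \<subseteq> parcs G \<and>
     parcs G \<subseteq> quotient_arcs f (parcs (H_digraph a n))"

lemma
  assumes "H_quotient f a n G"
  shows H_quotient_verts: "pverts G = f ` H_verts a n"
    and H_quotient_row: "(i, j) \<in> H_verts a n \<Longrightarrow> (i', j') \<in> H_verts a n \<Longrightarrow> f (i, j) = f (i', j') \<Longrightarrow> i = i'"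
    and H_quotient_interval: "(i, l) \<in> H_verts a n \<Longrightarrow> j \<le> k \<Longrightarrow> k \<le> l \<Longrightarrow> f (i, j) = f (i, l) \<Longrightarrow> f (i, k) = f (i, j)"
    and H_quotient_path_arcs: "quotient_arcs f (H_path_arcs a n) \<subseteq> parcs G"
    and H_quotient_arcs: "parcs G \<subseteq> quotient_arcs f (parcs (H_digraph a n))"
  using assms unfolding H_quotient_def by blast+

section \<open>Contractions and deletions lead to quotients\<close>

lemma H_quotient_id: "H_quotient id a n (H_digraph a n)"
  using H_path_arcs_subset by (auto simp: H_quotient_def) (auto simp: H_digraph_def)

lemma merge_into_eq_iff:
  "merge_into u v x = merge_into u v y \<longleftrightarrow> x = y \<or> x \<in> {u, v} \<and> y \<in> {u, v}"
  by (auto simp: merge_into_def)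

text \<open>The fibres over \<open>u\<close> and \<open>v\<close> are adjacent intervals of the same
  row, so their union is again an interval of that row; all other fibres are unchanged.\<close>

lemma H_quotient_contract:
  assumes q: "H_quotient f a n G" and uv: "(u, v) \<in> quotient_arcs f (H_path_arcs a n)"
  shows "H_quotient (merge_into u v \<circ> f) a n (contract G u v)"
proof -
  note row = H_quotient_row[OF q] and interval = H_quotient_interval[OF q]
  obtain i j where ij: "i < a" "Suc j < n" "u = f (i, j)" "v = f (i, Suc j)" "u \<noteq> v"
    using uv by (auto simp: quotient_arcs_def H_path_arcs_def)
  have in_row: "h = i" if "f (h, k) \<in> {u, v}" "(h, k) \<in> H_verts a n" for h k
    using that ij row[of h k i j] row[of h k i "Suc j"] by (auto simp: H_verts_def)
  have "f (h, m) \<in> {u, v}"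
    if hl: "(h, l) \<in> H_verts a n" and k: "k \<le> m" "m \<le> l" and f: "f (h, k) \<in> {u, v}" "f (h, l) \<in> {u, v}"
    for h k l m
  proof -
    have h: "h = i" using in_row[OF f(2) hl] .
    have l: "i < a" "l < n" using hl h by (auto simp: H_verts_def)
    show ?thesis
    proof (cases "m \<le> j")
      case True
      \<comment> \<open>A \<open>v\<close> in a column up to \<open>j\<close> would spread to column
        \<open>j\<close> by the interval condition, where the value is \<open>u\<close>. So
        \<open>u\<close> fills the stretch from \<open>k\<close> to \<open>j\<close>; the other case
        is the mirror image, with \<open>v\<close> from \<open>Suc j\<close> to
        \<open>l\<close>.\<close>
      have "f (i, k) \<noteq> v"
        using interval[of i "Suc j" k j] True k ij by (auto simp: H_verts_def)
      then show ?thesis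
        using interval[of i j k m] True k f ij h by (auto simp: H_verts_def)
    next
      case False
      have "f (i, l) \<noteq> u"
        using interval[of i l j "Suc j"] False k ij l by (auto simp: H_verts_def)
      then show ?thesis
        using interval[of i l "Suc j" m] False k f ij h l by (auto simp: H_verts_def)
    qed
  qed
  note mid = this
  show ?thesis
    unfolding H_quotient_def
  proof (intro conjI allI impI)
    show "pverts (contract G u v) = (merge_into u v \<circ> f) ` H_verts a n"
      by (simp add: contract_def H_quotient_verts[OF q] image_comp)
    show "h = h'" if "(h, k) \<in> H_verts a n" "(h', k') \<in> H_verts a n"
      "(merge_into u v \<circ> f) (h, k) = (merge_into u v \<circ> f) (h', k')" for h k h' k'
      using that row[of h k h' k'] in_row[of h k] in_row[of h' k'] by (auto simp: merge_into_eq_iff)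
    show "(merge_into u v \<circ> f) (h, m) = (merge_into u v \<circ> f) (h, k)"
      if "(h, l) \<in> H_verts a n" "k \<le> m" "m \<le> l"
        "(merge_into u v \<circ> f) (h, k) = (merge_into u v \<circ> f) (h, l)" for h k m l
      using that interval[of h l k m] mid[of h l k m]
      unfolding o_apply merge_into_eq_iff by metis
    show "quotient_arcs (merge_into u v \<circ> f) (H_path_arcs a n) \<subseteq> parcs (contract G u v)"
      using quotient_arcs_mono[OF H_quotient_path_arcs[OF q]]
      by (simp add: contract_def contract_arcs_eq_quotient_arcs flip: quotient_arcs_comp)
    show "parcs (contract G u v) \<subseteq> quotient_arcs (merge_into u v \<circ> f) (parcs (H_digraph a n))"
      using quotient_arcs_mono[OF H_quotient_arcs[OF q]]
      by (simp add: contract_def contract_arcs_eq_quotient_arcs flip: quotient_arcs_comp)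
  qed
qed

lemma H_quotient_delete_arc:
  assumes q: "H_quotient f a n G" and e: "e \<notin> quotient_arcs f (H_path_arcs a n)"
  shows "H_quotient f a n (delete_arc G e)"
proof -
  have "quotient_arcs f (H_path_arcs a n) \<subseteq> parcs G - {e}"
    using H_quotient_path_arcs[OF q] e by (simp add: subset_Diff_insert)
  moreover have "parcs G - {e} \<subseteq> quotient_arcs f (parcs (H_digraph a n))"
    by (rule order.trans[OF Diff_subset H_quotient_arcs[OF q]])
  ultimately show ?thesis
    using q unfolding H_quotient_def delete_arc_def pair_pre_digraph.simps
    by (elim conjE) (intro conjI; assumption)
qed

text \<open>The invariant also describes \<open>P\<close> as the image of the original path arcs.
  This lets a contraction compose \<open>f\<close> with \<open>merge_into\<close> at a genuine path
  arc, and keeps every deletion away from those images.\<close>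

lemma reduces_to_H_quotient:
  assumes "reduces_to (H_digraph a n) (H_path_arcs a n) G P"
  shows "\<exists>f. H_quotient f a n G \<and> P = quotient_arcs f (H_path_arcs a n)"
  using assms
proof induction
  case refl
  then show ?case using H_quotient_id quotient_arcs_id_H_path_arcs by metis
next
  case (contract_path_arc G P u v)
  then obtain f where f: "H_quotient f a n G" "P = quotient_arcs f (H_path_arcs a n)" by blast
  show ?case
  proof (intro exI conjI)
    show "H_quotient (merge_into u v \<circ> f) a n (contract G u v)"
      using H_quotient_contract[OF f(1)] contract_path_arc(2) f(2) by simp
    show "contract_arcs u v P = quotient_arcs (merge_into u v \<circ> f) (H_path_arcs a n)"
      unfolding f(2) contract_arcs_eq_quotient_arcs by (rule quotient_arcs_comp)
  qed
next
  case (delete_non_path_arc G P e)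
  then obtain f where f: "H_quotient f a n G" "P = quotient_arcs f (H_path_arcs a n)" by blast
  have "e \<notin> quotient_arcs f (H_path_arcs a n)" using delete_non_path_arc(2) f(2) by simp
  from H_quotient_delete_arc[OF f(1) this] f(2) show ?case by (intro exI conjI)
qed

section \<open>Transport of quotients along digraph isomorphisms\<close>

lemma H_quotient_inj_comp:
  assumes q: "H_quotient f a n G" and h: "inj_on h (pverts G)"
    and K: "pverts K = h ` pverts G" "parcs K = map_prod h h ` parcs G"
  shows "H_quotient (h \<circ> f) a n K"
proof -
  note verts = H_quotient_verts[OF q]
  have inj: "inj_on h (f ` H_verts a n)" using h verts by simp
  have eq: "h (f x) = h (f y) \<longleftrightarrow> f x = f y" if "x \<in> H_verts a n" "y \<in> H_verts a n" for x y
    using inj_on_eq_iff[OF inj] that by blast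
  have sub: "H_path_arcs a n \<subseteq> H_verts a n \<times> H_verts a n"
    using H_path_arcs_subset parcs_H_digraph_subset by blast
  show ?thesis
    unfolding H_quotient_def quotient_arcs_inj_comp[OF inj sub]
      quotient_arcs_inj_comp[OF inj parcs_H_digraph_subset]
  proof (intro conjI allI impI)
    show "pverts K = (h \<circ> f) ` H_verts a n" using K verts by (simp add: image_comp)
    show "i = i'" if "(i, j) \<in> H_verts a n" "(i', j') \<in> H_verts a n" "(h \<circ> f) (i, j) = (h \<circ> f) (i', j')"
      for i j i' j'
      using that H_quotient_row[OF q] eq by auto
    show "(h \<circ> f) (i, k) = (h \<circ> f) (i, j)"
      if "(i, l) \<in> H_verts a n" "j \<le> k" "k \<le> l" "(h \<circ> f) (i, j) = (h \<circ> f) (i, l)" for i j k l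
    proof -
      have "(i, j) \<in> H_verts a n" using that by (auto simp: H_verts_def)
      then have "f (i, j) = f (i, l)" using that eq by auto
      then show ?thesis using H_quotient_interval[OF q that(1-3)] by simp
    qed
  qed (use K H_quotient_path_arcs[OF q] H_quotient_arcs[OF q] in auto)
qed

text \<open>Arcs are pairs with \<open>fst\<close> as tail and \<open>snd\<close> as head, so the
  separate arc map of a library isomorphism is determined by its vertex map.\<close>

lemma digraph_iso_with_proj_iff:
  "digraph_iso (with_proj G) (with_proj K) \<longleftrightarrow> wf_digraph (with_proj G) \<and>
     (\<exists>h. inj_on h (pverts G) \<and> pverts K = h ` pverts G \<and> parcs K = map_prod h h ` parcs G)"
  (is "?L \<longleftrightarrow> ?W \<and> ?R")
proof (intro iffI conjI)
  assume ?L
  then obtain f where f: "pre_digraph.digraph_isomorphism (with_proj G) f"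
    and K: "with_proj K = app_iso f (with_proj G)" unfolding digraph_iso_def by blast
  show ?W using f unfolding pre_digraph.digraph_isomorphism_def by blast
  \<comment> \<open>Equality of the two records includes equality of their tail and head functions,
    which pins down \<open>iso_tail f\<close> and \<open>iso_head f\<close>.\<close>
  have "fst = iso_tail f" "snd = iso_head f"
    and verts: "pverts K = iso_verts f ` pverts G" and arcs: "parcs K = iso_arcs f ` parcs G"
    using K by (simp_all add: with_proj_def app_iso_def)
  then have "iso_arcs f e = map_prod (iso_verts f) (iso_verts f) e" if "e \<in> parcs G" for e
    using f that unfolding pre_digraph.digraph_isomorphism_def
    by (cases e) (auto simp: prod_eq_iff)
  then have "parcs K = map_prod (iso_verts f) (iso_verts f) ` parcs G"
    using arcs by (metis (no_types, lifting) image_cong)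
  then show ?R
    using f verts unfolding pre_digraph.digraph_isomorphism_def by auto
next
  assume asm: "?W \<and> ?R"
  then interpret wf_digraph "with_proj G" by blast
  obtain h where h: "inj_on h (pverts G)" "pverts K = h ` pverts G" "parcs K = map_prod h h ` parcs G"
    using asm by blast
  have sub: "parcs G \<subseteq> pverts G \<times> pverts G"
    using wellformed by fastforce
  have "inj_on (map_prod h h) (parcs G)"
    by (rule inj_on_subset[OF map_prod_inj_on[OF h(1) h(1)] sub])
  then have "digraph_isomorphism
      \<lparr> iso_verts = h, iso_arcs = map_prod h h, iso_head = snd, iso_tail = fst \<rparr>"
    using h(1) wf_digraph_axioms unfolding digraph_isomorphism_def by auto
  moreover have "with_proj K = app_iso
      \<lparr> iso_verts = h, iso_arcs = map_prod h h, iso_head = snd, iso_tail = fst \<rparr> (with_proj G)"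
    by (simp add: with_proj_def app_iso_def h)
  ultimately show ?L unfolding digraph_iso_def by blast
qed

lemma obtainable_from_H_imp_H_quotient:
  assumes "obtainable_from_H \<Gamma> a n"
  shows "\<exists>f. H_quotient f a n \<Gamma>"
proof -
  obtain G P where red: "reduces_to (H_digraph a n) (H_path_arcs a n) G P"
    and "digraph_iso (with_proj G) (with_proj \<Gamma>)"
    using assms unfolding obtainable_from_H_def by blast
  then obtain h where h: "inj_on h (pverts G)" "pverts \<Gamma> = h ` pverts G"
    "parcs \<Gamma> = map_prod h h ` parcs G"
    unfolding digraph_iso_with_proj_iff by (elim conjE exE)
  obtain f where "H_quotient f a n G" using reduces_to_H_quotient[OF red] by (elim exE conjE)
  from H_quotient_inj_comp[OF this h] show ?thesis by (rule exI[where x = "h \<circ> f"])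
qed

section \<open>Realising a quotient: contractions first (up to \<open>full_quotient\<close>), then
  deletions\<close>

definition full_quotient :: "(nat \<times> nat \<Rightarrow> 'a) \<Rightarrow> nat \<Rightarrow> nat \<Rightarrow> 'a pair_pre_digraph" where
  "full_quotient g a n =
     \<lparr> pverts = g ` H_verts a n, parcs = quotient_arcs g (parcs (H_digraph a n)) \<rparr>"

lemma contract_full_quotient:
  "contract (full_quotient g a n) u v = full_quotient (merge_into u v \<circ> g) a n"
  by (simp add: contract_def full_quotient_def contract_arcs_eq_quotient_arcs quotient_arcs_comp image_comp)

lemma full_quotient_id: "full_quotient id a n = H_digraph a n"
  unfolding full_quotient_def quotient_arcs_id_H_digraph by (simp add: H_digraph_def)

lemma first_change:
  fixes g :: "nat \<Rightarrow> 'a"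
  assumes "j \<le> l" "g j \<noteq> g l"
  obtains k where "j \<le> k" "k < l" "g k \<noteq> g (Suc k)"
  using assms
proof (induction l arbitrary: thesis)
  case (Suc l)
  show ?case
  proof (cases "j \<le> l \<and> g j \<noteq> g l")
    case True
    then show ?thesis using Suc by (metis less_Suc_eq)
  next
    case False
    then show ?thesis using Suc by (metis le_SucE lessI)
  qed
qed auto

text \<open>The fibres of \<open>g\<close> refine those of \<open>f\<close>. As long as the
  refinement is proper, some path arc inside a fibre of \<open>f\<close> is not yet contracted;
  contracting it keeps the refinement and lowers the number of values of \<open>g\<close>, on which
  the induction runs.\<close>

lemma reduces_to_full_quotient:
  assumes q: "H_quotient f a n G"
    and red: "reduces_to (H_digraph a n) (H_path_arcs a n) (full_quotient g a n)
      (quotient_arcs g (H_path_arcs a n))"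
    and factor: "\<And>x y. x \<in> H_verts a n \<Longrightarrow> y \<in> H_verts a n \<Longrightarrow> g x = g y \<Longrightarrow> f x = f y"
  shows "\<exists>g. reduces_to (H_digraph a n) (H_path_arcs a n) (full_quotient g a n)
      (quotient_arcs g (H_path_arcs a n)) \<and>
    (\<forall>x\<in>H_verts a n. \<forall>y\<in>H_verts a n. g x = g y \<longleftrightarrow> f x = f y)"
  using red factor
proof (induction "card (g ` H_verts a n)" arbitrary: g rule: less_induct)
  case less
  show ?case
  proof (cases "\<exists>x\<in>H_verts a n. \<exists>y\<in>H_verts a n. f x = f y \<and> g x \<noteq> g y")
    case True
    then obtain i j i' l where ij: "(i, j) \<in> H_verts a n" "(i', l) \<in> H_verts a n"
      "f (i, j) = f (i', l)" "g (i, j) \<noteq> g (i', l)" "j \<le> l"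
      by (metis nle_le surj_pair)
    then have [simp]: "i' = i" using H_quotient_row[OF q] by blast
    obtain k where k: "j \<le> k" "k < l" "g (i, k) \<noteq> g (i, Suc k)"
      using first_change[of j l "\<lambda>k. g (i, k)"] ij by auto
    define u v where "u = g (i, k)" and "v = g (i, Suc k)"
    define g' where "g' = merge_into u v \<circ> g"
    have verts: "(i, k) \<in> H_verts a n" "(i, Suc k) \<in> H_verts a n"
      using ij k by (auto simp: H_verts_def)
    \<comment> \<open>Columns \<open>k\<close> and \<open>Suc k\<close> lie between \<open>j\<close>
      and \<open>l\<close>, hence in the same fibre of \<open>f\<close>; merging \<open>u\<close>
      and \<open>v\<close> therefore identifies nothing that \<open>f\<close> separates.\<close>
    have feq: "f (i, Suc k) = f (i, k)"
      using H_quotient_interval[OF q, of i l j k] H_quotient_interval[OF q, of i l j "Suc k"] ij k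
      by auto
    have "(u, v) \<in> quotient_arcs g (H_path_arcs a n)"
      using k verts unfolding quotient_arcs_def H_path_arcs_def u_def v_def by (auto simp: H_verts_def)
    from contract_path_arc[OF less.prems(1) this]
    have red': "reduces_to (H_digraph a n) (H_path_arcs a n) (full_quotient g' a n)
      (quotient_arcs g' (H_path_arcs a n))"
      by (simp add: contract_full_quotient contract_arcs_eq_quotient_arcs quotient_arcs_comp g'_def)
    have factor': "f x = f y" if "x \<in> H_verts a n" "y \<in> H_verts a n" "g' x = g' y" for x y
      using that less.prems(2)[of x y] less.prems(2)[of x "(i, k)"] less.prems(2)[of x "(i, Suc k)"]
        less.prems(2)[of y "(i, k)"] less.prems(2)[of y "(i, Suc k)"] verts feq
      by (auto simp: g'_def merge_into_eq_iff u_def v_def)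
    have "g' ` H_verts a n \<subset> g ` H_verts a n"
    proof
      show "g' ` H_verts a n \<subseteq> g ` H_verts a n"
        using verts by (auto simp: g'_def merge_into_def u_def)
      \<comment> \<open>The merged vertex keeps the name \<open>u\<close>, so the value
        \<open>v\<close> disappears and the image shrinks strictly.\<close>
      have "v \<in> g ` H_verts a n" "v \<notin> g' ` H_verts a n"
        using verts k by (auto simp: g'_def merge_into_def u_def v_def)
      then show "g' ` H_verts a n \<noteq> g ` H_verts a n" by blast
    qed
    moreover have "finite (g ` H_verts a n)" by (simp add: H_verts_def)
    ultimately have "card (g' ` H_verts a n) < card (g ` H_verts a n)" by (rule psubset_card_mono[rotated])
    then show ?thesis using less.hyps red' factor' by blast
  next
    case False
    then show ?thesis using less.prems by blast
  qed
qed

lemma reduces_to_delete_arcs: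
  assumes "reduces_to G P K Q" "finite D" "D \<subseteq> parcs K - Q"
  shows "reduces_to G P \<lparr> pverts = pverts K, parcs = parcs K - D \<rparr> Q"
  using assms(2,3)
proof (induction D)
  case empty
  then show ?case using assms(1) by (cases K) simp
next
  case (insert e D)
  then have "reduces_to G P (delete_arc \<lparr> pverts = pverts K, parcs = parcs K - D \<rparr> e) Q"
    by (intro delete_non_path_arc) auto
  moreover have "parcs K - D - {e} = parcs K - insert e D" by blast
  ultimately show ?case by (simp add: delete_arc_def)
qed

lemma H_quotient_imp_obtainable_from_H:
  assumes q: "H_quotient f a n G"
  shows "obtainable_from_H G a n"
proof -
  have "reduces_to (H_digraph a n) (H_path_arcs a n) (full_quotient id a n)
      (quotient_arcs id (H_path_arcs a n))"
    by (simp add: full_quotient_id reduces_to.refl)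
  from reduces_to_full_quotient[OF q this]
  obtain g where red: "reduces_to (H_digraph a n) (H_path_arcs a n) (full_quotient g a n)
      (quotient_arcs g (H_path_arcs a n))"
    and g: "\<And>x y. x \<in> H_verts a n \<Longrightarrow> y \<in> H_verts a n \<Longrightarrow> g x = g y \<longleftrightarrow> f x = f y"
    by auto
  \<comment> \<open>On the grid \<open>g\<close> and \<open>f\<close> have the same fibres, so the
    choice of preimage does not matter: \<open>h\<close> is the bijection from the values of
    \<open>g\<close> to the vertices of \<open>G\<close> with \<open>h (g x) = f x\<close>.\<close>
  define h where "h = f \<circ> inv_into (H_verts a n) g"
  have hg: "h (g x) = f x" if "x \<in> H_verts a n" for x
    using g[of x "inv_into (H_verts a n) g (g x)"] that
    by (simp add: h_def f_inv_into_f inv_into_into)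
  have inj: "inj_on h (g ` H_verts a n)" using hg g by (auto simp: inj_on_def)
  let ?Q = "quotient_arcs g (H_path_arcs a n)" and ?A = "quotient_arcs g (parcs (H_digraph a n))"
  \<comment> \<open>These are the surplus arcs left after the contractions. None is the image of a
    path arc, since such images correspond to arcs of \<open>G\<close>; hence all of them may be
    deleted.\<close>
  define D where "D = {e \<in> ?A. map_prod h h e \<notin> parcs G}"
  define K where "K = \<lparr> pverts = g ` H_verts a n, parcs = ?A - D \<rparr>"
  have sub: "?A \<subseteq> g ` H_verts a n \<times> g ` H_verts a n"
    using parcs_H_digraph_subset unfolding quotient_arcs_def by fastforce
  have fin: "finite D"
    by (rule finite_subset[of _ "g ` H_verts a n \<times> g ` H_verts a n"])
      (use sub in \<open>auto simp: D_def H_verts_def\<close>)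
  have comp: "map_prod h h ` quotient_arcs g A = quotient_arcs f A" if "A \<subseteq> H_verts a n \<times> H_verts a n" for A
    using quotient_arcs_inj_comp[OF inj that] quotient_arcs_cong[OF that, of "h \<circ> g" f] hg by simp
  have "map_prod h h ` ?Q \<subseteq> parcs G"
    using comp[of "H_path_arcs a n"] H_quotient_path_arcs[OF q] H_path_arcs_subset
      parcs_H_digraph_subset by blast
  then have "D \<subseteq> parcs (full_quotient g a n) - ?Q"
    by (auto simp: D_def full_quotient_def)
  from reduces_to_delete_arcs[OF red fin this]
  have "reduces_to (H_digraph a n) (H_path_arcs a n) K ?Q"
    by (simp add: full_quotient_def K_def)
  moreover have "digraph_iso (with_proj K) (with_proj G)"
    unfolding digraph_iso_with_proj_iff
  proof (intro conjI exI)
    show "wf_digraph (with_proj K)"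
      by unfold_locales (use sub in \<open>auto simp: K_def\<close>)
    show "inj_on h (pverts K)" using inj by (simp add: K_def)
    show "pverts G = h ` pverts K"
      using hg by (auto simp: K_def H_quotient_verts[OF q] image_image)
    have K: "parcs K = {e \<in> ?A. map_prod h h e \<in> parcs G}" by (auto simp: K_def D_def)
    show "parcs G = map_prod h h ` parcs K"
    proof (intro equalityI subsetI)
      fix d assume d: "d \<in> parcs G"
      then have "d \<in> map_prod h h ` ?A"
        using comp[OF parcs_H_digraph_subset] H_quotient_arcs[OF q] by (metis subsetD)
      then obtain c where c: "c \<in> ?A" "d = map_prod h h c" by (rule imageE)
      then have "c \<in> parcs K" unfolding K using d by simp
      then show "d \<in> map_prod h h ` parcs K" unfolding c(2) by (rule imageI)
    qed (use K in auto)
  qed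
  ultimately show ?thesis unfolding obtainable_from_H_def by blast
qed

lemma obtainable_from_H_iff: "obtainable_from_H G a n \<longleftrightarrow> (\<exists>f. H_quotient f a n G)"
  using obtainable_from_H_imp_H_quotient H_quotient_imp_obtainable_from_H by blast

subsection \<open>Zero forcing in quotients of $H_{a,n}$\<close>

lemma valid_forces_append:
  "valid_forces G S (fs @ gs) \<longleftrightarrow> valid_forces G S fs \<and> valid_forces G (S \<union> snd ` set fs) gs"
  by (induction fs arbitrary: S) auto

lemma can_force_mono: "can_force G S u w \<Longrightarrow> S \<subseteq> S' \<Longrightarrow> w \<notin> S' \<Longrightarrow> can_force G S' u w"
  unfolding can_force_def by blast

text \<open>Forces available at the same blue set do not disturb each other: the blue set only
  grows, and distinctness keeps every target white until its turn.\<close>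

lemma valid_forces_simultaneous:
  assumes "\<And>u w. (u, w) \<in> set fs \<Longrightarrow> can_force G S u w" "distinct (map snd fs)"
  shows "valid_forces G S fs"
  using assms
proof (induction fs arbitrary: S)
  case (Cons e fs)
  obtain u w where [simp]: "e = (u, w)" by (cases e)
  have "can_force G (insert w S) u' w'" if "(u', w') \<in> set fs" for u' w'
  proof (rule can_force_mono)
    show "can_force G S u' w'" using Cons.prems(1) that by simp
    then show "w' \<notin> insert w S"
      using that Cons.prems(2) by (force simp: can_force_def)
  qed blast
  then show ?case using Cons by simp
qed simp

text \<open>Every arc leaving \<open>f (i, k)\<close> is the image of an arc leaving its fibre,
  which ends at column \<open>k\<close>. Arcs of the grid advance by at most one column and only
  within their row, so \<open>f (i, Suc k)\<close> is the only head that can be white.\<close>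

lemma H_quotient_can_force:
  assumes q: "H_quotient f a n G" and ik: "i < a" "Suc k < n"
    and S: "f ` H_verts a (Suc k) \<subseteq> S" "f (i, Suc k) \<notin> S"
  shows "can_force G S (f (i, k)) (f (i, Suc k))"
proof -
  have u: "f (i, k) \<in> S" using S ik by (auto simp: H_verts_def)
  then have neq: "f (i, k) \<noteq> f (i, Suc k)" using S by auto
  then have "(f (i, k), f (i, Suc k)) \<in> quotient_arcs f (H_path_arcs a n)"
    using ik by (auto simp: quotient_arcs_def H_path_arcs_def)
  then have arc: "(f (i, k), f (i, Suc k)) \<in> parcs G" using H_quotient_path_arcs[OF q] by blast
  have "y \<in> S" if "(f (i, k), y) \<in> parcs G" "y \<noteq> f (i, Suc k)" for y
  proof -
    have "(f (i, k), y) \<in> quotient_arcs f (parcs (H_digraph a n))"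
      using that(1) H_quotient_arcs[OF q] by blast
    then obtain h m l r where hm: "((h, m), (l, r)) \<in> parcs (H_digraph a n)"
      "f (h, m) = f (i, k)" "y = f (l, r)"
      unfolding quotient_arcs_def by auto
    then have verts: "(h, m) \<in> H_verts a n" "(l, r) \<in> H_verts a n" and r: "r \<le> m \<or> l = h \<and> r = Suc m"
      by (auto simp: H_digraph_arc_iff)
    have h: "h = i" using H_quotient_row[OF q verts(1) _ hm(2)] ik by (auto simp: H_verts_def)
    \<comment> \<open>If the fibre reached beyond column \<open>k\<close>, it would contain
      \<open>(i, Suc k)\<close> by the interval condition, contradicting \<open>neq\<close>.\<close>
    have "m \<le> k"
      using H_quotient_interval[OF q verts(1), of k "Suc k"] hm neq h by fastforce
    moreover have "r \<noteq> Suc k" if "l = i" using that \<open>y \<noteq> _\<close> hm by auto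
    ultimately have "r \<le> k" using r h by (auto simp: le_Suc_eq)
    then show ?thesis using S verts hm by (auto simp: H_verts_def)
  qed
  then show ?thesis using u arc S(2) unfolding can_force_def out_nbrs_def by blast
qed

lemma H_verts_Suc: "H_verts a (Suc n) = H_verts a n \<union> (\<lambda>i. (i, n)) ` {0..<a}"
  by (auto simp: H_verts_def)

lemma H_quotient_parcs_subset:
  assumes q: "H_quotient f a n G"
  shows "parcs G \<subseteq> pverts G \<times> pverts G"
  using H_quotient_arcs[OF q] H_quotient_verts[OF q] parcs_H_digraph_subset
  unfolding quotient_arcs_def by blast

lemma forced_upto_subset:
  assumes "parcs G \<subseteq> pverts G \<times> pverts G" "B \<subseteq> pverts G"
  shows "forced_upto G B F k \<subseteq> pverts G"
  using assms by (induction k) (auto simp: can_force_def out_nbrs_def)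

text \<open>Once the columns up to \<open>k\<close> are blue, every force into column
  \<open>Suc k\<close> is available. Only an inclusion is claimed, because vertices of later columns
  may turn blue ahead of schedule.\<close>

lemma H_quotient_forced_upto:
  assumes q: "H_quotient f a n G" and "k < n"
  shows "f ` H_verts a (Suc k) \<subseteq>
    forced_upto G (f ` H_verts a (Suc 0)) (quotient_arcs f (H_path_arcs a n)) k"
  using assms(2)
proof (induction k)
  case (Suc k)
  let ?F = "quotient_arcs f (H_path_arcs a n)"
  let ?S = "forced_upto G (f ` H_verts a (Suc 0)) ?F k"
  have IH: "f ` H_verts a (Suc k) \<subseteq> ?S" using Suc by simp
  have step: "f (i, Suc k) \<in> forced_upto G (f ` H_verts a (Suc 0)) ?F (Suc k)" if "i < a" for i
  proof (cases "f (i, Suc k) \<in> ?S")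
    case False
    have cf: "can_force G ?S (f (i, k)) (f (i, Suc k))"
      using H_quotient_can_force[OF q that Suc.prems IH False] .
    then have "f (i, k) \<noteq> f (i, Suc k)" using False by (auto simp: can_force_def)
    then have "(f (i, k), f (i, Suc k)) \<in> ?F"
      using that Suc.prems by (auto simp: quotient_arcs_def H_path_arcs_def)
    then show ?thesis using cf False by auto
  qed simp
  have "f ` H_verts a (Suc k) \<subseteq> forced_upto G (f ` H_verts a (Suc 0)) ?F (Suc k)"
    using IH by auto
  then show ?case
    unfolding H_verts_Suc[of a "Suc k"] image_Un using step by (auto simp del: forced_upto.simps)
qed simp

text \<open>In each row, column \<open>Suc k\<close> either repeats the value of column
  \<open>k\<close> or is the target of a force, so the targets account for everything beyond column
  \<open>0\<close>.\<close>

lemma blue_after_path_forces: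
  "f ` H_verts a (Suc 0) \<union> snd ` quotient_arcs f (H_path_arcs a (Suc k)) = f ` H_verts a (Suc k)"
proof (induction k)
  case 0
  then show ?case by (auto simp: quotient_arcs_def H_path_arcs_def)
next
  case (Suc k)
  have step: "quotient_arcs f (H_path_arcs a (Suc (Suc k))) = quotient_arcs f (H_path_arcs a (Suc k)) \<union>
      {(f (i, k), f (i, Suc k)) |i. i < a \<and> f (i, k) \<noteq> f (i, Suc k)}"
    unfolding quotient_arcs_H_path_arcs by (auto simp: less_Suc_eq)
  have "snd ` {(f (i, k), f (i, Suc k)) |i. i < a \<and> f (i, k) \<noteq> f (i, Suc k)} =
      {f (i, Suc k) |i. i < a \<and> f (i, k) \<noteq> f (i, Suc k)}"
    by force
  then have "f ` H_verts a (Suc 0) \<union> snd ` quotient_arcs f (H_path_arcs a (Suc (Suc k))) =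
      f ` H_verts a (Suc k) \<union> {f (i, Suc k) |i. i < a \<and> f (i, k) \<noteq> f (i, Suc k)}"
    unfolding step image_Un Un_assoc[symmetric] Suc by simp
  also have "\<dots> = f ` H_verts a (Suc (Suc k))"
  proof -
    have "f (i, Suc k) \<in> f ` H_verts a (Suc k)" if "i < a" "f (i, k) = f (i, Suc k)" for i
      unfolding that(2)[symmetric] using that(1) by (simp add: H_verts_def)
    then show ?thesis unfolding H_verts_Suc[of a "Suc k"] image_Un by auto
  qed
  finally show ?case .
qed

text \<open>A sequential order for the path forces, as \<open>set_of_forces\<close> demands: column
  by column, with the forces into one column performed in any order.\<close>

lemma H_quotient_valid_forces:
  assumes q: "H_quotient f a n G" and "k < n"
  shows "\<exists>fs. set fs = quotient_arcs f (H_path_arcs a (Suc k)) \<and>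
    valid_forces G (f ` H_verts a (Suc 0)) fs"
  using assms(2)
proof (induction k)
  case 0
  show ?case by (rule exI[of _ "[]"]) (auto simp: quotient_arcs_def H_path_arcs_def)
next
  case (Suc k)
  then obtain fs where fs: "set fs = quotient_arcs f (H_path_arcs a (Suc k))"
    "valid_forces G (f ` H_verts a (Suc 0)) fs" by auto
  define gs where "gs = map (\<lambda>i. (f (i, k), f (i, Suc k)))
      (filter (\<lambda>i. f (i, k) \<noteq> f (i, Suc k)) [0..<a])"
  have set_gs: "set gs = {(f (i, k), f (i, Suc k)) |i. i < a \<and> f (i, k) \<noteq> f (i, Suc k)}"
    by (auto simp: gs_def)
  \<comment> \<open>If the target occurred in an earlier column, it would be in the same row, and
    the interval condition would give \<open>f (i, k) = f (i, Suc k)\<close>.\<close>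
  have new: "f (i, Suc k) \<notin> f ` H_verts a (Suc k)" if "i < a" "f (i, k) \<noteq> f (i, Suc k)" for i
  proof
    assume "f (i, Suc k) \<in> f ` H_verts a (Suc k)"
    then obtain h j where hj: "h < a" "j \<le> k" "f (i, Suc k) = f (h, j)"
      by (auto simp: H_verts_def less_Suc_eq_le)
    moreover have "h = i"
      using H_quotient_row[OF q _ _ hj(3)] hj Suc.prems that by (auto simp: H_verts_def)
    ultimately show False
      using H_quotient_interval[OF q, of i "Suc k" j k] that Suc.prems by (auto simp: H_verts_def)
  qed
  have "inj_on (\<lambda>i. f (i, Suc k)) {0..<a}"
    using H_quotient_row[OF q] Suc.prems by (auto simp: inj_on_def H_verts_def)
  then have "distinct (map snd gs)"
    by (auto simp: gs_def distinct_map o_def elim: inj_on_subset)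
  then have "valid_forces G (f ` H_verts a (Suc k)) gs"
    using H_quotient_can_force[OF q _ Suc.prems order.refl] new
    by (intro valid_forces_simultaneous) (auto simp: set_gs)
  then have "valid_forces G (f ` H_verts a (Suc 0)) (fs @ gs)"
    using fs by (simp add: valid_forces_append blue_after_path_forces)
  moreover have "set (fs @ gs) = quotient_arcs f (H_path_arcs a (Suc (Suc k)))"
    using fs(1) by (auto simp: set_gs quotient_arcs_H_path_arcs less_Suc_eq)
  ultimately show ?case by blast
qed

lemma H_quotient_throttling_number_le:
  assumes q: "H_quotient f a (Suc b) G"
  shows "throttling_number G \<le> enat (a + b)"
proof -
  define B F where "B = f ` H_verts a (Suc 0)" and "F = quotient_arcs f (H_path_arcs a (Suc b))"
  note verts = H_quotient_verts[OF q] and arcs = H_quotient_parcs_subset[OF q]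
  have B: "B \<subseteq> pverts G" using verts by (auto simp: B_def H_verts_def)
  have "forced_upto G B F b = pverts G"
  proof
    show "forced_upto G B F b \<subseteq> pverts G" by (rule forced_upto_subset[OF arcs B])
    show "pverts G \<subseteq> forced_upto G B F b"
      using H_quotient_forced_upto[OF q, of b] verts by (simp add: B_def F_def)
  qed
  then have pt: "pt_forces G B F \<le> enat b"
    unfolding pt_forces_def by (auto intro: Inf_lower)
  obtain fs where fs: "set fs = F" "valid_forces G B fs"
    using H_quotient_valid_forces[OF q, of b] by (auto simp: B_def F_def)
  \<comment> \<open>With all vertices blue, no white out-neighbour is left, which is the maximality
    required in \<open>set_of_forces\<close>.\<close>
  have "B \<union> snd ` set fs = pverts G"
    using blue_after_path_forces[of f a b] fs verts by (simp add: B_def F_def)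
  then have "set_of_forces G B F"
    unfolding set_of_forces_def using fs arcs
    by (intro exI[of _ fs]) (auto simp: can_force_def out_nbrs_def)
  then have "pt_set G B \<le> pt_forces G B F"
    unfolding pt_set_def by (auto intro: Inf_lower)
  then have "pt_set G B \<le> enat b" using pt by simp
  moreover have "card B \<le> a"
    using card_image_le[of "H_verts a (Suc 0)" f] by (simp add: B_def H_verts_def)
  ultimately have "th_set G B \<le> enat (a + b)"
    unfolding th_set_def plus_enat_simps(1)[symmetric] by (intro add_mono) auto
  then show ?thesis
    unfolding throttling_number_def using B by (auto intro: Inf_lower2)
qed

subsection \<open>Forcing chains as rows\<close>

text \<open>An abstract record of a propagation process: \<open>\<tau> x\<close> is the round in
  which \<open>x\<close> turns blue, and \<open>forcer w\<close> is the vertex that forces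
  \<open>w\<close>. The color change rule becomes \<open>other_time\<close>: all other
  out-neighbours of the forcer turned blue in strictly earlier rounds.\<close>

locale timed_forces =
  fixes G :: "'a pair_pre_digraph" and B :: "'a set" and forcer :: "'a \<Rightarrow> 'a" and \<tau> :: "'a \<Rightarrow> nat"
  assumes arcs_subset: "parcs G \<subseteq> pverts G \<times> pverts G"
    and loopfree: "(x, x) \<notin> parcs G"
    and B_subset: "B \<subseteq> pverts G"
    and B_time: "x \<in> pverts G \<Longrightarrow> x \<in> B \<longleftrightarrow> \<tau> x = 0"
    and forcer_arc: "w \<in> pverts G - B \<Longrightarrow> (forcer w, w) \<in> parcs G"
    and forcer_time: "w \<in> pverts G - B \<Longrightarrow> \<tau> (forcer w) < \<tau> w"
    and other_time: "w \<in> pverts G - B \<Longrightarrow> (forcer w, v) \<in> parcs G \<Longrightarrow> v \<noteq> w \<Longrightarrow> \<tau> v < \<tau> w"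
begin

text \<open>If one vertex forced two, each of them would have to be blue strictly before the
  other.\<close>

lemma forcer_inj:
  assumes "w \<in> pverts G - B" "w' \<in> pverts G - B" "forcer w = forcer w'"
  shows "w = w'"
  using assms other_time[of w w'] other_time[of w' w] forcer_arc[of w] forcer_arc[of w'] by force

text \<open>\<open>chain x j\<close> is the last vertex that is blue at time \<open>j\<close> in the forcing chain starting at \<open>x\<close>.\<close>

primrec chain :: "'a \<Rightarrow> nat \<Rightarrow> 'a" where
  "chain x 0 = x"
| "chain x (Suc j) = (if \<exists>w\<in>pverts G - B. forcer w = chain x j \<and> \<tau> w = Suc j
     then THE w. w \<in> pverts G - B \<and> forcer w = chain x j \<and> \<tau> w = Suc j else chain x j)"

lemma chain_Suc_force:
  assumes "w \<in> pverts G - B" "forcer w = chain x j" "\<tau> w = Suc j"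
  shows "chain x (Suc j) = w"
proof -
  have "(THE w. w \<in> pverts G - B \<and> forcer w = chain x j \<and> \<tau> w = Suc j) = w"
    using assms forcer_inj by (intro the_equality) auto
  then show ?thesis using assms by auto
qed

lemma chain_Suc_cases:
  obtains (force) w where "w \<in> pverts G - B" "forcer w = chain x j" "\<tau> w = Suc j" "chain x (Suc j) = w"
  | (stay) "\<And>w. w \<in> pverts G - B \<Longrightarrow> forcer w = chain x j \<Longrightarrow> \<tau> w \<noteq> Suc j" "chain x (Suc j) = chain x j"
proof (cases "\<exists>w\<in>pverts G - B. forcer w = chain x j \<and> \<tau> w = Suc j")
  case True
  then show ?thesis using force chain_Suc_force by blast
next
  case False
  show ?thesis by (rule stay) (use False in auto)
qed

declare chain.simps(2) [simp del]

lemma chain_in_verts: "x \<in> B \<Longrightarrow> chain x j \<in> pverts G"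
proof (induction j)
  case (Suc j)
  then show ?case by (cases x j rule: chain_Suc_cases) auto
qed (use B_subset in auto)

text \<open>The current chain vertex is blue by time \<open>j\<close> and has forced nothing by
  then. Hence its force, if any, is still ahead and the chain cannot miss it.\<close>

lemma chain_time:
  assumes "x \<in> B"
  shows "\<tau> (chain x j) \<le> j \<and> (\<forall>w\<in>pverts G - B. forcer w = chain x j \<longrightarrow> j < \<tau> w)"
proof (induction j)
  case 0
  then show ?case using assms B_subset B_time by auto
next
  case (Suc j)
  show ?case
  proof (cases x j rule: chain_Suc_cases)
    case (force w)
    then show ?thesis using forcer_time by (metis order.refl)
  next
    case stay
    then show ?thesis using Suc by (metis Suc_lessI le_SucI)
  qed
qed

text \<open>A chain moves only by forces, whose targets lie outside \<open>B\<close> and are entered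
  exactly at their time; one column earlier the chain stood at the forcer. This allows a chain to be
  traced back to its start.\<close>

lemma chain_backward:
  assumes "x \<in> B"
  shows "(chain x j \<in> B \<longrightarrow> chain x j = x) \<and>
    (chain x j \<notin> B \<longrightarrow> chain x (\<tau> (chain x j) - 1) = forcer (chain x j))"
proof (induction j)
  case (Suc j)
  then show ?case by (cases x j rule: chain_Suc_cases) auto
qed (use assms in auto)

text \<open>From a common vertex both chains are traced back through the same forcers, with
  decreasing times, until they reach a vertex of \<open>B\<close>, which must be the start of
  both.\<close>

lemma chain_start_inj:
  assumes "x \<in> B" "y \<in> B" "chain x j = chain y k"
  shows "x = y"
  using assms(3)
proof (induction "\<tau> (chain x j)" arbitrary: j k rule: less_induct)
  case less
  show ?case
  proof (cases "chain x j \<in> B")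
    case True
    then show ?thesis using chain_backward assms less.prems by metis
  next
    case False
    let ?m = "\<tau> (chain x j) - 1"
    have "chain x ?m = forcer (chain x j)" "chain y ?m = forcer (chain x j)"
      using False chain_backward assms(1,2) less.prems by metis+
    moreover have "\<tau> (forcer (chain x j)) < \<tau> (chain x j)"
      using False chain_in_verts[OF assms(1)] forcer_time by blast
    ultimately show ?thesis using less.hyps by metis
  qed
qed

lemma chain_constant:
  assumes "j \<le> k" "\<And>w. w \<in> pverts G - B \<Longrightarrow> forcer w = chain x j \<Longrightarrow> k < \<tau> w"
  shows "chain x k = chain x j"
  using assms
proof (induction k)
  case (Suc k)
  show ?case
  proof (cases "j \<le> k")
    case True
    then have "chain x k = chain x j" using Suc by (meson Suc_lessD)
    then show ?thesis
      using Suc.prems(2) by (cases x k rule: chain_Suc_cases) (metis less_irrefl, simp)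
  next
    case False
    then show ?thesis using Suc.prems(1) by (metis le_SucE)
  qed
qed simp

text \<open>By \<open>chain_time\<close>, a vertex still current at time \<open>l\<close> has forced
  nothing up to \<open>l\<close>, so the chain cannot have left it in between.\<close>

lemma chain_interval:
  assumes "x \<in> B" "j \<le> k" "k \<le> l" "chain x j = chain x l"
  shows "chain x k = chain x j"
  using assms chain_time[OF assms(1), of l] by (intro chain_constant) auto

text \<open>By induction the forcer of \<open>v\<close> lies on some chain at its own time. As it
  forces only \<open>v\<close>, the chain waits there until column \<open>\<tau> v - 1\<close> and
  then moves to \<open>v\<close>.\<close>

lemma chain_surj:
  assumes "v \<in> pverts G"
  shows "\<exists>x\<in>B. chain x (\<tau> v) = v"
  using assms
proof (induction "\<tau> v" arbitrary: v rule: less_induct)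
  case less
  show ?case
  proof (cases "v \<in> B")
    case True
    then show ?thesis using B_time less.prems by auto
  next
    case False
    then have v: "v \<in> pverts G - B" using less.prems by blast
    have "forcer v \<in> pverts G" using forcer_arc[OF v] arcs_subset by blast
    then obtain x where x: "x \<in> B" "chain x (\<tau> (forcer v)) = forcer v"
      using less.hyps forcer_time[OF v] by blast
    have "\<tau> v \<noteq> 0" using forcer_time[OF v] by auto
    then obtain m where m: "\<tau> v = Suc m" using not0_implies_Suc by blast
    have "chain x m = forcer v"
      using chain_constant[of "\<tau> (forcer v)" m x] forcer_time[OF v] x(2) m v forcer_inj by force
    then show ?thesis using chain_Suc_force[OF v _ m] x(1) m by metis
  qed
qed

lemma H_quotient_chains:
  assumes bound: "\<And>v. v \<in> pverts G \<Longrightarrow> \<tau> v \<le> b" and e: "bij_betw e {0..<a} B"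
  shows "H_quotient (\<lambda>(i, j). chain (e i) j) a (Suc b) G"
proof -
  have eB: "e i \<in> B" if "i < a" for i using e that by (auto dest: bij_betwE)
  have surj: "\<exists>i<a. chain (e i) (\<tau> v) = v" if v: "v \<in> pverts G" for v
  proof -
    obtain x where "x \<in> B" "chain x (\<tau> v) = v" using chain_surj[OF v] by blast
    moreover then obtain i where "i < a" "x = e i" using bij_betw_imp_surj_on[OF e] by auto
    ultimately show ?thesis by blast
  qed
  have arc: "\<exists>i k l m. ((i, k), (l, m)) \<in> parcs (H_digraph a (Suc b)) \<and>
      u = chain (e i) k \<and> v = chain (e l) m" if uv: "(u, v) \<in> parcs G" for u v
  proof -
    have V: "u \<in> pverts G" "v \<in> pverts G" using uv arcs_subset by auto
    have "u \<noteq> v" using uv loopfree by auto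
    obtain i l where i: "i < a" "chain (e i) (\<tau> u) = u" and l: "l < a" "chain (e l) (\<tau> v) = v"
      using surj V by metis
    have stays: "chain (e i) k = u"
      if "\<tau> u \<le> k" "\<And>w. w \<in> pverts G - B \<Longrightarrow> forcer w = u \<Longrightarrow> k < \<tau> w" for k
      using chain_constant[of "\<tau> u" k "e i"] that i by simp
    \<comment> \<open>It suffices to find a column \<open>k\<close> in the fibre of \<open>u\<close>
      by which \<open>v\<close> is blue: the grid has arcs from column \<open>k\<close> to every
      other vertex in columns up to \<open>k\<close>.\<close>
    have final: ?thesis if "chain (e i) k = u" "\<tau> v \<le> k" "k \<le> b" for k
      using that i l \<open>u \<noteq> v\<close>
      by (intro exI[of _ i] exI[of _ k] exI[of _ l] exI[of _ "\<tau> v"])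
        (auto simp: H_digraph_arc_iff H_verts_def)
    show ?thesis
    proof (cases "\<exists>w\<in>pverts G - B. forcer w = u")
      case False
      \<comment> \<open>A vertex that never forces stays current up to the last column
        \<open>b\<close>, and \<open>v\<close> is blue by then.\<close>
      then show ?thesis using final[of b] stays[of b] bound V by blast
    next
      case True
      then obtain w where w: "w \<in> pverts G - B" "forcer w = u" by blast
      then have "\<tau> u < \<tau> w" using forcer_time by blast
      then obtain m where m: "\<tau> w = Suc m" "\<tau> u \<le> m" by (cases "\<tau> w") auto
      \<comment> \<open>Column \<open>m\<close>, just before \<open>u\<close> forces
        \<open>w\<close>, still shows \<open>u\<close>. The arc to \<open>w\<close> is then the
        image of a path arc, and any other out-neighbour of \<open>u\<close> is blue by time
        \<open>m\<close>.\<close>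
      have um: "chain (e i) m = u" using stays[of m] m w forcer_inj by force
      have "Suc m \<le> b" using bound w m by fastforce
      show ?thesis
      proof (cases "v = w")
        case True
        then have "chain (e i) (Suc m) = v" using chain_Suc_force[OF w(1) _ m(1)] w um by metis
        then show ?thesis
          using um i \<open>Suc m \<le> b\<close>
          by (intro exI[of _ i] exI[of _ m] exI[of _ i] exI[of _ "Suc m"])
            (auto simp: H_digraph_arc_iff H_verts_def)
      next
        case False
        then have "\<tau> v \<le> m" using other_time[OF w(1)] w uv m by fastforce
        then show ?thesis using final um \<open>Suc m \<le> b\<close> by simp
      qed
    qed
  qed
  show ?thesis
    unfolding H_quotient_def
  proof (intro conjI allI impI)
    show "pverts G = (\<lambda>(i, j). chain (e i) j) ` H_verts a (Suc b)"
    proof (intro equalityI subsetI)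
      fix v assume v: "v \<in> pverts G"
      then obtain i where "i < a" "chain (e i) (\<tau> v) = v" using surj by blast
      then show "v \<in> (\<lambda>(i, j). chain (e i) j) ` H_verts a (Suc b)"
        using bound[OF v] by (intro rev_image_eqI[of "(i, \<tau> v)"]) (auto simp: H_verts_def)
    qed (use chain_in_verts eB in \<open>auto simp: H_verts_def\<close>)
    show "i = i'" if "(i, j) \<in> H_verts a (Suc b)" "(i', j') \<in> H_verts a (Suc b)"
      "(case (i, j) of (i, j) \<Rightarrow> chain (e i) j) = (case (i', j') of (i, j) \<Rightarrow> chain (e i) j)" for i j i' j'
    proof -
      have "i < a" "i' < a" using that by (auto simp: H_verts_def)
      moreover then have "e i = e i'" using chain_start_inj eB that(3) by simp
      ultimately show ?thesis using bij_betw_imp_inj_on[OF e] by (auto dest: inj_onD)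
    qed
    show "(case (i, k) of (i, j) \<Rightarrow> chain (e i) j) = (case (i, j) of (i, j) \<Rightarrow> chain (e i) j)"
      if "(i, l) \<in> H_verts a (Suc b)" "j \<le> k" "k \<le> l"
        "(case (i, j) of (i, j) \<Rightarrow> chain (e i) j) = (case (i, l) of (i, j) \<Rightarrow> chain (e i) j)" for i j k l
      using that chain_interval[of "e i" j k l] eB by (auto simp: H_verts_def)
    \<comment> \<open>A row changes its value only by a force, so distinct consecutive values are
      joined by the arc from forcer to forced vertex.\<close>
    have "(chain (e i) j, chain (e i) (Suc j)) \<in> parcs G" if "chain (e i) j \<noteq> chain (e i) (Suc j)" for i j
      using that forcer_arc by (cases "e i" j rule: chain_Suc_cases) metis+
    then show "quotient_arcs (\<lambda>(i, j). chain (e i) j) (H_path_arcs a (Suc b)) \<subseteq> parcs G"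
      by (auto simp: quotient_arcs_def H_path_arcs_def)
    show "parcs G \<subseteq> quotient_arcs (\<lambda>(i, j). chain (e i) j) (parcs (H_digraph a (Suc b)))"
    proof
      fix d assume d: "d \<in> parcs G"
      obtain u v where uv: "d = (u, v)" by (cases d)
      obtain i k l m where "((i, k), (l, m)) \<in> parcs (H_digraph a (Suc b))"
        "u = chain (e i) k" "v = chain (e l) m"
        using arc d uv by blast
      moreover have "u \<noteq> v" using d uv loopfree by auto
      ultimately show "d \<in> quotient_arcs (\<lambda>(i, j). chain (e i) j) (parcs (H_digraph a (Suc b)))"
        unfolding quotient_arcs_def uv by fastforce
    qed
  qed
qed

end

section \<open>Times and forcers of a propagation process\<close>

lemma forced_upto_imp_H_quotient:
  assumes G: "pair_digraph G" and B: "B \<subseteq> pverts G" and full: "pverts G \<subseteq> forced_upto G B F b"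
  shows "\<exists>f. H_quotient f (card B) (Suc b) G"
proof -
  interpret pair_digraph G by (rule G)
  let ?S = "forced_upto G B F"
  define \<tau> where "\<tau> x = (LEAST k. x \<in> ?S k)" for x
  \<comment> \<open>Stage \<open>\<tau> w - 1\<close> is the last one at which \<open>w\<close> is
    white; this is applied only to \<open>w\<close> outside \<open>B\<close>, where
    \<open>\<tau> w\<close> is positive. Several vertices may be able to force \<open>w\<close> at
    that stage, and one is chosen.\<close>
  define forcer where "forcer w = (SOME u. can_force G (?S (\<tau> w - 1)) u w)" for w
  have blue: "v \<in> ?S (\<tau> v)" if "v \<in> ?S k" for v k
    unfolding \<tau>_def using that by (rule LeastI)
  have le: "\<tau> v \<le> k" if "v \<in> ?S k" for v k
    unfolding \<tau>_def using that by (rule Least_le)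
  have zero: "x \<in> B \<longleftrightarrow> \<tau> x = 0" if "x \<in> pverts G" for x
    using blue[of x b] le[of x 0] full that by (metis forced_upto.simps(1) le_zero_eq subsetD)
  have force: "can_force G (?S (\<tau> w - 1)) (forcer w) w" "0 < \<tau> w" if w: "w \<in> pverts G - B" for w
  proof -
    have "\<tau> w \<noteq> 0" using zero w by blast
    then obtain m where m: "\<tau> w = Suc m" using not0_implies_Suc by blast
    have "w \<notin> ?S m" using le[of w m] m by auto
    moreover have "w \<in> ?S (Suc m)" using blue[of w b] full w m by auto
    ultimately have "\<exists>u. can_force G (?S (\<tau> w - 1)) u w" using m by auto
    then show "can_force G (?S (\<tau> w - 1)) (forcer w) w" unfolding forcer_def by (rule someI_ex)
    show "0 < \<tau> w" using m by simp
  qed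
  have before: "\<tau> v < \<tau> w" if "v \<in> ?S (\<tau> w - 1)" "0 < \<tau> w" for v w
    using le[OF that(1)] that(2) by simp
  interpret timed_forces G B forcer \<tau>
  proof
    show "parcs G \<subseteq> pverts G \<times> pverts G" using in_arcsD1 in_arcsD2 by auto
    show "(x, x) \<notin> parcs G" for x using pair_no_loops by fastforce
    show "(forcer w, w) \<in> parcs G" if "w \<in> pverts G - B" for w
      using force[OF that] by (auto simp: can_force_def out_nbrs_def)
    show "\<tau> (forcer w) < \<tau> w" if "w \<in> pverts G - B" for w
      using force[OF that] before by (auto simp: can_force_def)
    show "\<tau> v < \<tau> w" if "w \<in> pverts G - B" "(forcer w, v) \<in> parcs G" "v \<noteq> w" for v w
      using force[OF that(1)] before that(2,3) by (auto simp: can_force_def out_nbrs_def)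
  qed (use B zero in auto)
  have "finite B" using B pair_finite_verts finite_subset by blast
  then obtain e where "bij_betw e {0..<card B} B" using ex_bij_betw_nat_finite by blast
  then show ?thesis using H_quotient_chains le full by blast
qed

section \<open>From the throttling number to a propagation process, and the equivalence\<close>

lemma enat_Inf_le_enat:
  assumes "Inf A \<le> enat t"
  shows "\<exists>x\<in>A. x \<le> enat t"
proof -
  \<comment> \<open>The infimum of the empty set is infinite, and a nonempty set in
    \<open>enat\<close> attains its infimum.\<close>
  have "A \<noteq> {}" using assms by (auto simp: top_enat_def)
  then have "Inf A \<in> A" unfolding Inf_enat_def by (auto intro: LeastI)
  then show ?thesis using assms by blast
qed

text \<open>The three nested minima over \<open>B\<close>, \<open>F\<close> and the time are finite,
  so witnesses exist for each of them in turn.\<close>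

lemma throttling_number_le_imp_forced_upto:
  assumes "throttling_number G \<le> enat t"
  shows "\<exists>B F k. B \<subseteq> pverts G \<and> card B + k \<le> t \<and> forced_upto G B F k = pverts G"
proof -
  obtain B where B: "B \<subseteq> pverts G" "th_set G B \<le> enat t"
    using enat_Inf_le_enat assms unfolding throttling_number_def by blast
  then obtain s where s: "pt_set G B = enat s"
    unfolding th_set_def by (cases "pt_set G B") auto
  then obtain F where "pt_forces G B F \<le> enat s"
    using enat_Inf_le_enat[of "{pt_forces G B F |F. set_of_forces G B F}" s]
    unfolding pt_set_def by auto
  then obtain k where "forced_upto G B F k = pverts G" "k \<le> s"
    using enat_Inf_le_enat[of "{enat t |t. forced_upto G B F t = pverts G}" s]
    unfolding pt_forces_def by auto
  moreover have "card B + s \<le> t" using B(2) s unfolding th_set_def by simp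
  ultimately show ?thesis using B(1) by (meson add_left_mono order_trans)
qed

lemma forced_upto_mono: "k \<le> l \<Longrightarrow> forced_upto G B F k \<subseteq> forced_upto G B F l"
  by (rule lift_Suc_mono_le) auto

lemma forced_upto_empty: "forced_upto G {} F k = {}"
  by (induction k) (auto simp: can_force_def)

theorem theorem2p6:
  fixes \<Gamma> :: "'a pair_pre_digraph" and t :: nat
  assumes "pair_digraph \<Gamma>" and "pverts \<Gamma> \<noteq> {}" and "t > 0"
  shows "throttling_number \<Gamma> \<le> enat t \<longleftrightarrow>
    (\<exists>a b :: nat. a \<ge> 1 \<and> b \<ge> 0 \<and> a + b = t \<and> obtainable_from_H \<Gamma> a (b + 1))"
proof
  assume "throttling_number \<Gamma> \<le> enat t"
  then obtain B F k where B: "B \<subseteq> pverts \<Gamma>" "card B + k \<le> t" "forced_upto \<Gamma> B F k = pverts \<Gamma>"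
    using throttling_number_le_imp_forced_upto by blast
  interpret pair_digraph \<Gamma> by (rule assms(1))
  \<comment> \<open>From an empty blue set nothing is ever forced, so a nonempty vertex set yields
    at least one row.\<close>
  have "B \<noteq> {}" using B(3) assms(2) forced_upto_empty by metis
  then have "1 \<le> card B" using B(1) pair_finite_verts finite_subset by (metis One_nat_def Suc_leI card_gt_0_iff)
  \<comment> \<open>To meet \<open>a + b = t\<close> exactly, \<open>b\<close> is taken as
    \<open>t - card B\<close>, which may exceed \<open>k\<close>: waiting longer keeps all vertices
    blue and merely adds columns.\<close>
  moreover have "pverts \<Gamma> \<subseteq> forced_upto \<Gamma> B F (t - card B)"
    using forced_upto_mono[of k "t - card B"] B(2,3) by fastforce
  then have "obtainable_from_H \<Gamma> (card B) (t - card B + 1)"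
    using forced_upto_imp_H_quotient[OF assms(1) B(1)] by (auto simp: obtainable_from_H_iff)
  moreover have "card B + (t - card B) = t" using B(2) by simp
  ultimately show "\<exists>a b :: nat. a \<ge> 1 \<and> b \<ge> 0 \<and> a + b = t \<and> obtainable_from_H \<Gamma> a (b + 1)"
    by (metis le0)
next
  assume "\<exists>a b :: nat. a \<ge> 1 \<and> b \<ge> 0 \<and> a + b = t \<and> obtainable_from_H \<Gamma> a (b + 1)"
  then show "throttling_number \<Gamma> \<le> enat t"
    using H_quotient_throttling_number_le by (auto simp: obtainable_from_H_iff)
qed

end
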